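(* Let $k\geq 1$ be an integer, let $n\geq\max\{\frac{k^3}{2}+k+2,(k+1)^2\}$ be an integer, and let $G$ be a nearly balanced bipartite graph of order $2n-1$. If $\delta(G)\geq k$ and $$\mu(G)>\sqrt{n(n-k-1)},$$ then $G$ is traceable, unless $G=C_n^k$.
   Context: All graphs are finite and simple; equality of graphs is up to isomorphism. A bipartite graph with partite sets $X,Y$ is nearly balanced if $|X|=|Y|-1$. $\delta(G)$ is the minimum degree and $\mu(G)$ is the spectral radius, i.e. the largest eigenvalue of the adjacency matrix. A graph is traceable if it contains a Hamiltonian path. Bipartite graphs are taken with fixed ordered partite sets: $K_{a,b}$ is the complete bipartite graph and $O_{a,b}$ the edgeless bipartite graph with first part of size $a$ and second part of size $b$. For bipartite graphs $G_1,G_2$ with bipartitions $(X_1,Y_1)$, $(X_2,Y_2)$, $G_1\sqcup G_2$ is the graph obtained from the disjoint union of $G_1$ and $G_2$ by adding all edges between $X_1$ and $Y_2$ and all edges between $Y_1$ and $X_2$. For $1\leq k\leq n/2$, $C_n^k=O_{k,n-k}\sqcup K_{n-k-1,k}$. *)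

theory Defs
  imports
    Complex_Main
    "Graph_Theory.Graph_Theory"
    "Jordan_Normal_Form.Spectral_Radius"
begin

text \<open>
  A finite simple graph is a \<open>pair_graph\<close>: a finite, loop-free, symmetric digraph without
  parallel arcs, so that an undirected edge \<open>uv\<close> is the pair of arcs \<open>(u, v)\<close>, \<open>(v, u)\<close>.
\<close>

definition min_degree :: "'a pair_pre_digraph \<Rightarrow> nat" where
  "min_degree G = Min (out_degree G ` pverts G)"

definition traceable :: "'a pair_pre_digraph \<Rightarrow> bool" where
  "traceable G \<longleftrightarrow> (\<exists>p. vpath p G \<and> set p = pverts G)"

definition adjacency_matrix :: "'a pair_pre_digraph \<Rightarrow> 'a list \<Rightarrow> real mat" where
  "adjacency_matrix G vs =
     mat (length vs) (length vs) (\<lambda>(i, j). if (vs ! i, vs ! j) \<in> parcs G then 1 else 0)"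

text \<open>
  The numbering of the vertices is arbitrary: two numberings give adjacency matrices that are
  conjugate by a permutation matrix and hence have the same eigenvalues. The spectrum is the set
  of real eigenvalues; it is finite, and it is nonempty for a graph with at least one vertex
  since the matrix is symmetric.
\<close>

definition graph_spectral_radius :: "'a pair_pre_digraph \<Rightarrow> real" where
  "graph_spectral_radius G =
     Max (spectrum (adjacency_matrix G (SOME vs. distinct vs \<and> set vs = pverts G)))"

text \<open>
  Bipartite graphs with fixed ordered partite sets. Each undirected edge is stored once, as a
  pair directed from the first part to the second.
\<close>

record 'a bipgraph =
  part1 :: "'a set"
  part2 :: "'a set"
  bedges :: "('a \<times> 'a) set"

locale bipartite_graph =
  fixes G :: "'a bipgraph"
  assumes finite_part1: "finite (part1 G)"
    and finite_part2: "finite (part2 G)"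
    and parts_disjoint: "part1 G \<inter> part2 G = {}"
    and bedges_subset: "bedges G \<subseteq> part1 G \<times> part2 G"

definition underlying :: "'a bipgraph \<Rightarrow> 'a pair_pre_digraph" where
  "underlying G = \<lparr>pverts = part1 G \<union> part2 G, parcs = bedges G \<union> (bedges G)\<inverse>\<rparr>"

definition nearly_balanced :: "'a bipgraph \<Rightarrow> bool" where
  "nearly_balanced G \<longleftrightarrow> card (part1 G) + 1 = card (part2 G)"

definition graph_order :: "'a pair_pre_digraph \<Rightarrow> nat" where
  "graph_order G = card (pverts G)"

definition complete_bip :: "nat \<Rightarrow> nat \<Rightarrow> (nat + nat) bipgraph" where
  "complete_bip a b =
     \<lparr>part1 = Inl ` {..<a}, part2 = Inr ` {..<b}, bedges = Inl ` {..<a} \<times> Inr ` {..<b}\<rparr>"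

definition empty_bip :: "nat \<Rightarrow> nat \<Rightarrow> (nat + nat) bipgraph" where
  "empty_bip a b = \<lparr>part1 = Inl ` {..<a}, part2 = Inr ` {..<b}, bedges = {}\<rparr>"

text \<open>The vertex type \<open>'a + 'b\<close> makes the union of the two vertex sets disjoint.\<close>

definition bip_join :: "'a bipgraph \<Rightarrow> 'b bipgraph \<Rightarrow> ('a + 'b) bipgraph"  (infixl "\<squnion>\<^sub>b" 65) where
  "G \<squnion>\<^sub>b H =
     \<lparr>part1 = part1 G <+> part1 H,
      part2 = part2 G <+> part2 H,
      bedges = map_prod Inl Inl ` bedges G \<union> map_prod Inr Inr ` bedges H
        \<union> Inl ` part1 G \<times> Inr ` part2 H \<union> Inr ` part1 H \<times> Inl ` part2 G\<rparr>"

text \<open>Only used for \<open>1 \<le> k \<le> n / 2\<close>, where the subtractions do not truncate.\<close>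

definition C_graph :: "nat \<Rightarrow> nat \<Rightarrow> ((nat + nat) + (nat + nat)) bipgraph" where
  "C_graph n k = empty_bip k (n - k) \<squnion>\<^sub>b complete_bip (n - k - 1) k"

lemma (in bipartite_graph) pair_graph_underlying: "pair_graph (underlying G)"
proof -
  have "finite (bedges G)"
    by (rule finite_subset[OF bedges_subset]) (simp add: finite_part1 finite_part2)
  then show ?thesis
    using finite_part1 finite_part2 parts_disjoint bedges_subset
    by unfold_locales (auto simp: underlying_def symmetric_def sym_def)
qed

text \<open>Conversely, every bipartition of a simple graph arises in this way.\<close>

lemma bipartite_graph_exists:
  assumes "pair_graph H" and "pverts H = X \<union> Y" and "X \<inter> Y = {}"
    and "parcs H \<subseteq> X \<times> Y \<union> Y \<times> X"
  shows "\<exists>G. bipartite_graph G \<and> part1 G = X \<and> part2 G = Y \<and> underlying G = H"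
proof -
  interpret pair_graph H by fact
  have fin: "finite X" "finite Y"
    using assms(2) pair_finite_verts by simp_all
  let ?G = "\<lparr>part1 = X, part2 = Y, bedges = parcs H \<inter> X \<times> Y\<rparr>"
  have "bipartite_graph ?G"
    using fin assms(3) by unfold_locales auto
  moreover have "underlying ?G = H"
    using assms(2,4) arcs_symmetric by (auto simp: underlying_def intro!: pair_pre_digraph.equality)
  ultimately show ?thesis by fastforce
qed

lemma bipartite_graph_C_graph: "bipartite_graph (C_graph n k)"
  by unfold_locales (auto simp: C_graph_def bip_join_def empty_bip_def complete_bip_def)

end

theory Submission
  imports Defs "HOL-Analysis.Convex"
begin

text \<open>
  Let \<open>X\<close> and \<open>Y\<close> be the parts, of sizes \<open>n - 1\<close> and \<open>n\<close>, and let \<open>\<mu>\<close> be the spectral radius. The spectral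
  hypothesis is used twice, each time through a nonnegative weighting \<open>a\<close> of \<open>X\<close> derived from an
  eigenvector (\<open>spectral_radius_weighting\<close>): the squared neighbour sums of \<open>a\<close> over \<open>Y\<close> add up to at
  least \<open>\<mu>\<^sup>2\<close> times the squared norm of \<open>a\<close>.
  
  The first use is combinatorial. By Cauchy-Schwarz \<open>\<mu>\<^sup>2\<close> is at most the number of edges
  (\<open>sum_neighbour_weights_le_card\<close>), so the graph has more than \<open>n (n - k - 1)\<close> edges. If it is not
  traceable, extend it to an edge-maximal non-traceable bipartite graph on the same parts. In that
  graph adding any edge \<open>xy\<close> creates a spanning path, and rotating this path shows that the degrees of
  \<open>x\<close> and \<open>y\<close> sum to at most \<open>n - 1\<close> (\<open>nonadjacent_degree_sum_le\<close>). Together with the number of edges, the minimum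
  degree and \<open>n \<ge> (k + 1)\<^sup>2\<close>, this leaves exactly one possibility for the maximal graph: \<open>k\<close> vertices
  of \<open>X\<close> have the same \<open>k\<close> neighbours, and all other vertices of \<open>X\<close> are adjacent to all of \<open>Y\<close>
  (\<open>saturated_dense_structure\<close>). Hence the original graph is a subgraph of \<open>C_graph n k\<close>
  (\<open>dense_nontraceable_structure\<close>).
  
  The second use shows that it is not a proper subgraph. The minimum degree condition keeps all edges
  at the \<open>k\<close> small vertices, so a missing edge is incident with one of the other vertices of \<open>X\<close>. Without the
  small vertices the extremal graph would be a complete bipartite graph with \<open>\<mu>\<^sup>2 = n (n - k - 1)\<close>; the
  small vertices raise this value slightly, but for \<open>n \<ge> k\<^sup>3 / 2 + k + 2\<close> by no more than what the loss of
  a single edge takes away (\<open>extremal_quadratic_form_bound\<close>, \<open>proper_subgraph_weight_bound\<close>).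
\<close>

section \<open>Spanning paths in bipartite graphs\<close>

text \<open>
  Paths are lists of vertices over a bare edge set, with each edge stored in one orientation, so
  that edges can be added without rebuilding a graph record.
\<close>

definition spanning_path :: "'a set \<Rightarrow> ('a \<times> 'a) set \<Rightarrow> 'a list \<Rightarrow> bool" where
  "spanning_path V E p \<longleftrightarrow>
     distinct p \<and> set p = V \<and> successively (\<lambda>u v. (u, v) \<in> E \<union> E\<inverse>) p"

lemma set_vwalk_arcs_subset_iff:
  "set (vwalk_arcs p) \<subseteq> A \<longleftrightarrow> successively (\<lambda>u v. (u, v) \<in> A) p"
  by (induction p rule: vwalk_arcs.induct) auto

lemma traceable_underlying_iff:
  assumes "part1 G \<union> part2 G \<noteq> {}"
  shows "traceable (underlying G) \<longleftrightarrow> (\<exists>p. spanning_path (part1 G \<union> part2 G) (bedges G) p)"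
  unfolding traceable_def vpath_def vwalk_def spanning_path_def set_vwalk_arcs_subset_iff
    with_proj_simps
  using assms by (auto simp: underlying_def)

lemma spanning_path_rev: "spanning_path V E (rev p) \<longleftrightarrow> spanning_path V E p"
proof -
  have "successively (\<lambda>u v. (u, v) \<in> E \<union> E\<inverse>) (rev p) = successively (\<lambda>u v. (u, v) \<in> E \<union> E\<inverse>) p"
    unfolding successively_rev by (rule successively_cong) auto
  then show ?thesis by (simp add: spanning_path_def)
qed

text \<open>
  A path that starts in the larger part can be extended at its head by a new vertex of each part;
  this is what the condition on the head is for.
\<close>

lemma spanning_path_complete_bipartite:
  assumes "finite X" "finite Y" "X \<inter> Y = {}" "card Y = card X + 1"
  shows "\<exists>p. spanning_path (X \<union> Y) (X \<times> Y) p \<and> p \<noteq> [] \<and> hd p \<in> Y"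
  using assms
proof (induction X arbitrary: Y rule: finite_induct)
  case empty
  then obtain y where "Y = {y}" by (auto simp: card_1_singleton_iff)
  then have "spanning_path ({} \<union> Y) ({} \<times> Y) [y]" by (simp add: spanning_path_def)
  then show ?case using \<open>Y = {y}\<close> by (intro exI[of _ "[y]"]) simp
next
  case (insert x X)
  then have "Y \<noteq> {}" by auto
  then obtain y where y: "y \<in> Y" by blast
  have "X \<inter> (Y - {y}) = {}" and "card (Y - {y}) = card X + 1"
    using insert y by auto
  then obtain p where p: "spanning_path (X \<union> (Y - {y})) (X \<times> (Y - {y})) p" "p \<noteq> []" "hd p \<in> Y - {y}"
    using insert.IH[of "Y - {y}"] insert.prems(1) by auto
  have "successively (\<lambda>u v. (u, v) \<in> insert x X \<times> Y \<union> (insert x X \<times> Y)\<inverse>) p"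
    by (rule successively_mono[of "\<lambda>u v. (u, v) \<in> X \<times> (Y - {y}) \<union> (X \<times> (Y - {y}))\<inverse>"])
      (use p(1) in \<open>auto simp: spanning_path_def\<close>)
  moreover have "x \<notin> Y" "y \<notin> X" "x \<noteq> y" using insert.prems y by auto
  ultimately have "spanning_path (insert x X \<union> Y) (insert x X \<times> Y) (y # x # p)"
    using p insert.hyps y by (auto simp: spanning_path_def successively_Cons)
  then show ?case using y by (intro exI[of _ "y # x # p"]) simp
qed

text \<open>
  The bipartite form of Ore's rotation argument. Take a spanning path through the new edge \<open>xy\<close>.
  Sending each neighbour of \<open>x\<close> to its successor on the path is injective, takes values in \<open>X\<close>, and
  avoids the neighbours of \<open>y\<close>, since otherwise a spanning path without \<open>xy\<close> would arise. So the
  neighbourhood of \<open>x\<close> is no larger than the set of non-neighbours of \<open>y\<close> in \<open>X\<close>.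
\<close>

lemma nonadjacent_degree_sum_le:
  assumes fin: "finite X" and disj: "X \<inter> Y = {}" and E: "E \<subseteq> X \<times> Y"
    and xy: "x \<in> X" "y \<in> Y" "(x, y) \<notin> E"
    and path: "spanning_path (X \<union> Y) (insert (x, y) E) q"
    and none: "\<nexists>p. spanning_path (X \<union> Y) E p"
  shows "card (E `` {x}) + card (E\<inverse> `` {y}) \<le> card X"
proof -
  define adj where "adj = (\<lambda>u v. (u, v) \<in> E \<union> E\<inverse>)"
  have adj_sym: "adj u v \<longleftrightarrow> adj v u" for u v unfolding adj_def by blast
  have rev_adj: "successively adj (rev zs) \<longleftrightarrow> successively adj zs" for zs
    unfolding successively_rev by (rule successively_cong) (use adj_sym in auto)
  \<comment> \<open>The path must use the new edge; reversing it if necessary, it traverses that edge from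
    \<open>x\<close> to \<open>y\<close>.\<close>
  have "\<exists>as bs. spanning_path (X \<union> Y) (insert (x, y) E) (as @ bs)
      \<and> as \<noteq> [] \<and> bs \<noteq> [] \<and> last as = x \<and> hd bs = y"
  proof -
    have split: "successively P q \<or> (\<exists>as bs. q = as @ bs \<and> as \<noteq> [] \<and> bs \<noteq> [] \<and> \<not> P (last as) (hd bs))"
      for P :: "'a \<Rightarrow> 'a \<Rightarrow> bool" and q
    proof (induction q rule: induct_list012)
      case (3 u v zs)
      show ?case
      proof (cases "P u v")
        case True
        have "\<exists>as bs. u # v # zs = as @ bs \<and> as \<noteq> [] \<and> bs \<noteq> [] \<and> \<not> P (last as) (hd bs)"
          if "v # zs = as @ bs" "as \<noteq> []" "bs \<noteq> []" "\<not> P (last as) (hd bs)" for as bs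
          using that by (intro exI[of _ "u # as"] exI[of _ bs]) auto
        then show ?thesis using 3(2) True by auto
      next
        case False
        then show ?thesis by (intro disjI2 exI[of _ "[u]"] exI[of _ "v # zs"]) auto
      qed
    qed auto
    have "\<not> successively adj q"
      using none path unfolding spanning_path_def adj_def by blast
    then obtain as bs where q: "q = as @ bs" "as \<noteq> []" "bs \<noteq> []" "\<not> adj (last as) (hd bs)"
      using split[of adj q] by blast
    have "(last as, hd bs) \<in> insert (x, y) E \<union> (insert (x, y) E)\<inverse>"
      using path q(2,3) unfolding spanning_path_def q(1) successively_append_iff by blast
    then consider "last as = x" "hd bs = y" | "last as = y" "hd bs = x"
      using q(4) unfolding adj_def by auto
    then show ?thesis
    proof cases
      case 1
      then show ?thesis using path q by blast
    next
      case 2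
      have "spanning_path (X \<union> Y) (insert (x, y) E) (rev bs @ rev as)"
        using path unfolding q(1) by (simp flip: rev_append add: spanning_path_rev)
      then show ?thesis using 2 q by (intro exI[of _ "rev bs"] exI[of _ "rev as"]) (simp add: last_rev hd_rev)
    qed
  qed
  then obtain as bs where sp: "spanning_path (X \<union> Y) (insert (x, y) E) (as @ bs)"
    and ne: "as \<noteq> []" "bs \<noteq> []" and xl: "last as = x" and yh: "hd bs = y"
    by blast
  have dist: "distinct (as @ bs)" and set: "set (as @ bs) = X \<union> Y"
    and succ: "successively (\<lambda>u v. (u, v) \<in> insert (x, y) E \<union> (insert (x, y) E)\<inverse>) (as @ bs)"
    using sp unfolding spanning_path_def by blast+
  have xas: "x \<in> set as" and ybs: "y \<in> set bs" using ne xl yh by auto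
  have sas: "successively adj as"
    by (rule successively_mono[of "\<lambda>u v. (u, v) \<in> insert (x, y) E \<union> (insert (x, y) E)\<inverse>"])
      (use succ dist ybs in \<open>auto simp: successively_append_iff adj_def\<close>)
  have sbs: "successively adj bs"
    by (rule successively_mono[of "\<lambda>u v. (u, v) \<in> insert (x, y) E \<union> (insert (x, y) E)\<inverse>"])
      (use succ dist xas in \<open>auto simp: successively_append_iff adj_def\<close>)
  have no: False if "successively adj p" "distinct p" "set p = X \<union> Y" for p
    using none that unfolding spanning_path_def adj_def by blast

  \<comment> \<open>Every neighbour \<open>v\<close> of \<open>x\<close> has a successor \<open>w\<close> on the path, and \<open>w\<close> is not a neighbour of
    \<open>y\<close>: a missing successor or an edge \<open>wy\<close> would let the path be rotated past the gap.\<close>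
  have "\<exists>w P Q. as @ bs = P @ v # w # Q \<and> w \<in> X \<and> (w, y) \<notin> E" if v: "v \<in> E `` {x}" for v
  proof -
    have xv: "(x, v) \<in> E" and vY: "v \<in> Y" using v E by auto
    have vX: "w \<in> X" if "adj v w" for w using that vY E disj unfolding adj_def by auto
    have adjE: "(w, y) \<in> E \<longleftrightarrow> adj w y" if "w \<in> X" for w
      using that E disj xy unfolding adj_def by auto
    have "v \<in> set as \<or> v \<in> set bs" using set vY by auto
    then show ?thesis
    proof
      assume "v \<in> set as"
      then obtain P R where as: "as = P @ v # R" by (auto dest: split_list)
      have "R \<noteq> []" using as xl vY xy disj by auto
      then obtain w Q where R: "R = w # Q" by (cases R) auto
      have wX: "w \<in> X" using sas vX unfolding as R by (simp add: successively_append_iff)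
      have "\<not> adj w y"
      proof
        assume wy: "adj w y"
        have lastR: "last (w # Q) = x" using xl as R by simp
        \<comment> \<open>Reversing the stretch from \<open>w\<close> to \<open>x\<close> puts \<open>x\<close> next to \<open>v\<close> and \<open>w\<close> next to \<open>y\<close>.\<close>
        have "adj v x" using xv unfolding adj_def by auto
        then have "successively adj ((P @ [v]) @ rev (w # Q) @ bs)"
          using sas sbs lastR wy yh ne unfolding as R
          by (auto simp: successively_append_iff rev_adj hd_rev last_rev successively_Cons
              simp del: rev.simps successively_rev)
        then show False
          by (rule no) (use dist set in \<open>auto simp: as R\<close>)
      qed
      then show ?thesis using as R wX adjE by auto
    next
      assume "v \<in> set bs"
      then obtain P R where bs: "bs = P @ v # R" by (auto dest: split_list)
      \<comment> \<open>Here the stretch from \<open>y\<close> to \<open>v\<close> is reversed; \<open>y\<close> is then followed by \<open>w\<close>, or ends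
        the path if \<open>v\<close> was its last vertex.\<close>
      have xv': "adj x v" using xv unfolding adj_def by auto
      have lst: "hd (rev (P @ [v])) = v" "last (rev (P @ [v])) = y"
        using yh unfolding bs by (cases P; simp add: hd_rev last_rev)+
      have ss: "successively adj (as @ rev (P @ [v]))"
        using sas sbs xv' xl lst unfolding bs
        by (auto simp: successively_append_iff rev_adj successively_Cons
            simp del: rev_append rev.simps successively_rev)
      show ?thesis
      proof (cases R)
        case Nil
        have False
          by (rule no[OF ss]) (use dist set Nil in \<open>auto simp: bs\<close>)
        then show ?thesis ..
      next
        case (Cons w Q)
        have wX: "w \<in> X" using sbs vX unfolding bs Cons by (simp add: successively_append_iff)
        have "\<not> adj w y"
        proof
          assume wy: "adj w y"
          have "successively adj ((as @ rev (P @ [v])) @ w # Q)"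
            unfolding successively_append_iff[of _ "as @ rev (P @ [v])"]
            using ss sbs lst(2) wy adj_sym unfolding bs Cons
            by (auto simp: successively_append_iff simp del: rev_append successively_rev)
          then show False
            by (rule no) (use dist set in \<open>auto simp: bs Cons\<close>)
        qed
        moreover have "as @ bs = (as @ P) @ v # w # Q" using bs Cons by simp
        ultimately show ?thesis using wX adjE by blast
      qed
    qed
  qed
  then obtain f where f: "\<And>v. v \<in> E `` {x} \<Longrightarrow>
      (\<exists>P Q. as @ bs = P @ v # f v # Q) \<and> f v \<in> X \<and> (f v, y) \<notin> E"
    by metis
  have "inj_on f (E `` {x})"
  proof (rule inj_onI)
    fix v v' assume v: "v \<in> E `` {x}" "v' \<in> E `` {x}" and eq: "f v = f v'"
    obtain P Q where 1: "as @ bs = (P @ [v]) @ f v # Q" using f[OF v(1)] by auto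
    obtain P' Q' where 2: "as @ bs = (P' @ [v']) @ f v # Q'" using f[OF v(2)] eq by auto
    have "f v \<notin> set (P @ [v])" "f v \<notin> set Q"
      using dist unfolding 1 by auto
    then have "P @ [v] = P' @ [v']" using 1 2 by (metis append_Cons_eq_iff)
    then show "v = v'" by simp
  qed
  moreover have "f ` (E `` {x}) \<subseteq> X - E\<inverse> `` {y}" using f by auto
  ultimately have "card (E `` {x}) \<le> card (X - E\<inverse> `` {y})"
    by (rule card_inj_on_le) (use fin in auto)
  moreover have "E\<inverse> `` {y} \<subseteq> X" using E by auto
  ultimately show ?thesis
    using fin card_mono[OF fin, of "E\<inverse> `` {y}"] finite_subset[of "E\<inverse> `` {y}" X]
    by (simp add: card_Diff_subset)
qed

section \<open>Dense bipartite graphs without a spanning path\<close>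

lemma card_eq_sum_degrees:
  assumes "finite X" "finite Y" "E \<subseteq> X \<times> Y"
  shows "card E = (\<Sum>x\<in>X. card (E `` {x}))"
proof -
  have "E = Sigma X (\<lambda>x. E `` {x})" using assms by auto
  moreover have "\<forall>x\<in>X. finite (E `` {x})"
    using assms by (auto intro: finite_subset[of _ Y])
  ultimately show ?thesis using card_SigmaI[OF assms(1)] by metis
qed

lemma card_edges_at_le:
  assumes "finite A" "finite Y" and "E \<subseteq> X \<times> Y" and "\<And>x. x \<in> A \<Longrightarrow> card (E `` {x}) \<le> c"
  shows "card (E \<inter> A \<times> Y) \<le> card A * c"
proof -
  have "card (E \<inter> A \<times> Y) = (\<Sum>x\<in>A. card ((E \<inter> A \<times> Y) `` {x}))"
    by (rule card_eq_sum_degrees) (use assms in auto)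
  also have "\<dots> \<le> (\<Sum>x\<in>A. c)"
  proof (rule sum_mono)
    fix x assume "x \<in> A"
    moreover have "(E \<inter> A \<times> Y) `` {x} = E `` {x}" using \<open>x \<in> A\<close> assms(3) by auto
    ultimately show "card ((E \<inter> A \<times> Y) `` {x}) \<le> c" using assms(4) by simp
  qed
  finally show ?thesis by simp
qed

text \<open>
  This is the degree-sequence argument of Chvatal and of Moon and Moser, run on a saturated graph. A
  non-edge \<open>x0 y0\<close> with maximal degree sum yields \<open>i = d(x0)\<close> vertices of \<open>X\<close> with degree at most
  \<open>i\<close> and \<open>m + 1 - i\<close> vertices of \<open>Y\<close> with degree at most \<open>m - i\<close>. Counting edges leaves only
  \<open>i = k\<close>; then all edges outside the \<open>k\<close> small vertices of \<open>X\<close> are present, which pins down the graph.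
\<close>

lemma saturated_dense_structure:
  fixes m k :: nat
  assumes fin: "finite X" "finite Y" and E: "E \<subseteq> X \<times> Y"
    and cX: "card X = m" and cY: "card Y = m + 1"
    and sat: "\<And>x y. x \<in> X \<Longrightarrow> y \<in> Y \<Longrightarrow> (x, y) \<notin> E \<Longrightarrow> card (E `` {x}) + card (E\<inverse> `` {y}) \<le> m"
    and degX: "\<And>x. x \<in> X \<Longrightarrow> k \<le> card (E `` {x})"
    and degY: "\<And>y. y \<in> Y \<Longrightarrow> k \<le> card (E\<inverse> `` {y})"
    and ne: "E \<noteq> X \<times> Y"
    and big: "(m + 1) * (m - k) < card E" and mk: "(k + 1)\<^sup>2 \<le> m + 1"
  obtains X1 Y2 where "X1 \<subseteq> X" "Y2 \<subseteq> Y" "card X1 = k" "card Y2 = k"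
    and "E = X1 \<times> Y2 \<union> (X - X1) \<times> Y"
proof -
  let ?d = "\<lambda>x. card (E `` {x})" and ?e = "\<lambda>y. card (E\<inverse> `` {y})"
  let ?S = "X \<times> Y - E" and ?f = "\<lambda>p. ?d (fst p) + ?e (snd p)"
  have finS: "finite ?S" and neS: "?S \<noteq> {}" using fin ne E by auto
  \<comment> \<open>Among the non-edges, one with maximal degree sum bounds the degree of every non-neighbour
    of either end by the degree of the other end.\<close>
  have "Max (?f ` ?S) \<in> ?f ` ?S" using finS neS by (intro Max_in) auto
  then obtain x0 y0 where xy: "x0 \<in> X" "y0 \<in> Y" "(x0, y0) \<notin> E"
    and mx: "?d x0 + ?e y0 = Max (?f ` ?S)" by auto
  have max: "?d x + ?e y \<le> ?d x0 + ?e y0" if "x \<in> X" "y \<in> Y" "(x, y) \<notin> E" for x y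
  proof -
    have "?f (x, y) \<le> Max (?f ` ?S)"
      using finS that by (intro Max_ge finite_imageI imageI) auto
    then show ?thesis unfolding mx by simp
  qed
  define i where "i = ?d x0"
  have ie: "i + ?e y0 \<le> m" using sat xy i_def by simp
  have Efin: "finite (E `` {x})" "finite (E\<inverse> `` {y})" for x y
    using E fin by (auto intro: finite_subset[of _ Y] finite_subset[of _ X])
  define Y' where "Y' = Y - E `` {x0}"
  have sub0: "E `` {x0} \<subseteq> Y" "E\<inverse> `` {y0} \<subseteq> X" using E by auto
  have cY': "card Y' = m + 1 - i"
    unfolding Y'_def i_def using card_Diff_subset[OF Efin(1) sub0(1)] cY by simp
  have eY': "?e y \<le> m - i" if "y \<in> Y'" for y
    using max[of x0 y] that xy ie unfolding Y'_def i_def by auto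
  have "i \<le> card (X - E\<inverse> `` {y0})"
    using card_Diff_subset[OF Efin(2) sub0(2)] cX ie by simp
  then obtain X1 where X1: "X1 \<subseteq> X - E\<inverse> `` {y0}" "card X1 = i"
    by (meson obtain_subset_with_card_n)
  have X1X: "X1 \<subseteq> X" and finX1: "finite X1" using X1 fin by (auto intro: finite_subset)
  have dX1: "?d x \<le> i" if "x \<in> X1" for x
    using max[of x y0] that xy X1 unfolding i_def by auto
  have cX1: "card (X - X1) = m - i" using X1X finX1 X1(2) cX by (simp add: card_Diff_subset)
  have e1: "card (E \<inter> X1 \<times> Y) \<le> i * i"
    using card_edges_at_le[OF finX1 fin(2) E, of i] dX1 X1(2) by simp
  have i_lo: "k \<le> i" using degX xy i_def by simp
  have i_hi: "i + k \<le> m" using degY[OF xy(2)] ie by simp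
  \<comment> \<open>The degree bounds give at most \<open>(m + 1) (m - i) + i\<^sup>2\<close> edges. This is convex in \<open>i\<close> and takes
    equal values at \<open>k + 1\<close> and \<open>m - k\<close>, where it is at most \<open>(m + 1) (m - k)\<close>.\<close>
  have "i = k"
  proof (rule ccontr)
    assume "i \<noteq> k"
    then obtain a where a: "i = k + 1 + a" using i_lo by (metis Suc_eq_plus1 Suc_leI le_Suc_ex le_neq_implies_less)
    obtain b where b: "m = i + k + b" using i_hi by (metis le_Suc_ex)
    have "card (E\<inverse> \<inter> Y' \<times> X) \<le> (m + 1 - i) * (m - i)"
      using card_edges_at_le[of Y' X "E\<inverse>" Y "m - i"] fin E eY' cY' unfolding Y'_def by auto
    moreover have "E \<inter> X \<times> Y' = (E\<inverse> \<inter> Y' \<times> X)\<inverse>" by auto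
    ultimately have e2: "card (E \<inter> X \<times> Y') \<le> (m + 1 - i) * (m - i)" by simp
    have "card (Y - Y') = i"
      unfolding Y'_def i_def using sub0 by (simp add: double_diff)
    then have e3: "card ((X - X1) \<times> (Y - Y')) = (m - i) * i"
      using cX1 by (simp add: card_cartesian_product)
    have "E \<subseteq> (E \<inter> X1 \<times> Y) \<union> (E \<inter> X \<times> Y') \<union> (X - X1) \<times> (Y - Y')" using E by auto
    then have "card E \<le> card ((E \<inter> X1 \<times> Y) \<union> (E \<inter> X \<times> Y') \<union> (X - X1) \<times> (Y - Y'))"
      by (rule card_mono[rotated]) (use fin E finX1 in \<open>auto intro: finite_subset[of E "X \<times> Y"]\<close>)
    also have "\<dots> \<le> card (E \<inter> X1 \<times> Y) + card (E \<inter> X \<times> Y') + card ((X - X1) \<times> (Y - Y'))"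
      by (meson add_le_mono card_Un_le le_refl le_trans)
    also have "\<dots> \<le> i * i + (m + 1 - i) * (m - i) + (m - i) * i" using e1 e2 e3 by linarith
    finally have "(m + 1) * (m - k) < i * i + (m + 1 - i) * (m - i) + (m - i) * i" using big by simp
    moreover have "m - k = i + b" "m - i = k + b" "m + 1 - i = k + b + 1" using b by auto
    ultimately have "(m + 1) * (i + b) < i * i + (k + b + 1) * (k + b) + (k + b) * i" by simp
    moreover have "(k + b + 1) * (k + b) + (k + b) * i = (m + 1) * (k + b)" using b by (simp add: algebra_simps)
    ultimately have "(m + 1) * (i + b) < i * i + (m + 1) * (k + b)" by simp
    then have "(m + 1) * (a + 1) < (k + 1 + a) * (k + 1 + a)"
      unfolding a by (simp add: algebra_simps)
    moreover have "(m + 1) * a \<ge> (2 * k + 2 + a) * a" using a b by (intro mult_right_mono) auto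
    ultimately show False using mk by (simp add: algebra_simps power2_eq_square)
  qed
  \<comment> \<open>By the saturation hypothesis a single missing edge forces at least \<open>m - k\<close> missing edges at
    its two ends, while the edge count leaves room for fewer than \<open>k\<^sup>2\<close>.\<close>
  have full: "(X - X1) \<times> Y \<subseteq> E"
  proof (rule ccontr)
    assume "\<not> ?thesis"
    then obtain x y where x: "x \<in> X" "x \<notin> X1" and y: "y \<in> Y" and non: "(x, y) \<notin> E" by auto
    let ?T = "(X - X1) \<times> Y - E"
    have finT: "finite ?T" using fin by auto
    have "card (Y - E `` {x}) \<ge> m + 1 - ?d x" using diff_card_le_card_Diff[OF Efin(1)] cY by metis
    moreover have "card (X - X1 - {x} - E\<inverse> `` {y}) \<ge> m - k - 1 - ?e y"
    proof -
      have "card (X - X1 - {x}) = m - k - 1" using x cX1 \<open>i = k\<close> fin by simp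
      then show ?thesis using diff_card_le_card_Diff[OF Efin(2)] by metis
    qed
    moreover have "?d x + ?e y \<le> m" using sat x y non by simp
    moreover have "card (Y - E `` {x}) + card (X - X1 - {x} - E\<inverse> `` {y}) \<le> card ?T"
    proof -
      let ?A = "{x} \<times> (Y - E `` {x})" and ?B = "(X - X1 - {x} - E\<inverse> `` {y}) \<times> {y}"
      have "card ?A + card ?B = card (?A \<union> ?B)"
        by (rule card_Un_disjoint[symmetric]) (use fin in auto)
      also have "\<dots> \<le> card ?T" by (rule card_mono[OF finT]) (use x y in auto)
      finally show ?thesis by (simp add: card_cartesian_product)
    qed
    ultimately have T: "m - k \<le> card ?T" by linarith
    have "card (E \<inter> (X - X1) \<times> Y) + card ?T = card ((X - X1) \<times> Y)"
    proof -
      have "card (E \<inter> (X - X1) \<times> Y) + card ?T = card ((E \<inter> (X - X1) \<times> Y) \<union> ?T)"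
        by (rule card_Un_disjoint[symmetric]) (use fin in auto)
      also have "(E \<inter> (X - X1) \<times> Y) \<union> ?T = (X - X1) \<times> Y" by auto
      finally show ?thesis .
    qed
    also have "\<dots> = (m + 1) * (m - k)"
      using cX1 cY \<open>i = k\<close> by (simp add: card_cartesian_product mult.commute)
    finally have c1: "card (E \<inter> (X - X1) \<times> Y) + card ?T = (m + 1) * (m - k)" .
    have "card E \<le> card (E \<inter> X1 \<times> Y \<union> E \<inter> (X - X1) \<times> Y)"
      by (rule card_mono) (use fin E finX1 in auto)
    also have "\<dots> \<le> card (E \<inter> X1 \<times> Y) + card (E \<inter> (X - X1) \<times> Y)" by (rule card_Un_le)
    finally have "card E + card ?T \<le> k * k + (m + 1) * (m - k)" using c1 e1 unfolding \<open>i = k\<close> by linarith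
    then have "m - k < k * k" using T big by linarith
    then show False using mk by (simp add: power2_eq_square)
  qed
  define Y2 where "Y2 = E `` {x0}"
  have cY2: "card Y2 = k" using \<open>i = k\<close> by (simp add: Y2_def i_def)
  have Y2: "Y2 \<subseteq> Y" using sub0 by (simp add: Y2_def)
  have nbY': "E\<inverse> `` {y} = X - X1" if "y \<in> Y'" for y
  proof (rule card_seteq[symmetric, OF Efin(2)])
    show "X - X1 \<subseteq> E\<inverse> `` {y}" using full that unfolding Y'_def by auto
    show "card (E\<inverse> `` {y}) \<le> card (X - X1)" using eY'[OF that] cX1 by simp
  qed
  have nbX1: "E `` {x} = Y2" if "x \<in> X1" for x
  proof (rule card_seteq)
    show "finite Y2" using Efin Y2_def by simp
    show "E `` {x} \<subseteq> Y2"
      using nbY' E that unfolding Y'_def Y2_def by blast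
    show "card Y2 \<le> card (E `` {x})" using cY2 degX that X1X by auto
  qed
  have "E = X1 \<times> Y2 \<union> (X - X1) \<times> Y"
  proof (intro equalityI subsetI)
    fix p assume "p \<in> E"
    then show "p \<in> X1 \<times> Y2 \<union> (X - X1) \<times> Y" using E nbX1 by (cases p) auto
  next
    fix p assume "p \<in> X1 \<times> Y2 \<union> (X - X1) \<times> Y"
    then show "p \<in> E" using full nbX1 by (cases p) auto
  qed
  then show thesis using that X1X Y2 X1(2) \<open>i = k\<close> cY2 by blast
qed

text \<open>
  An edge-maximal graph without spanning path that contains \<open>E\<close> is saturated by
  \<open>nonadjacent_degree_sum_le\<close>, and complete bipartite graphs have spanning paths, so the saturated graph is the
  extremal one.
\<close>

lemma dense_nontraceable_structure:
  fixes m k :: nat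
  assumes fin: "finite X" "finite Y" and disj: "X \<inter> Y = {}" and E: "E \<subseteq> X \<times> Y"
    and cX: "card X = m" and cY: "card Y = m + 1"
    and none: "\<nexists>p. spanning_path (X \<union> Y) E p"
    and degX: "\<And>x. x \<in> X \<Longrightarrow> k \<le> card (E `` {x})"
    and degY: "\<And>y. y \<in> Y \<Longrightarrow> k \<le> card (E\<inverse> `` {y})"
    and big: "(m + 1) * (m - k) < card E" and mk: "(k + 1)\<^sup>2 \<le> m + 1"
  obtains X1 Y2 where "X1 \<subseteq> X" "Y2 \<subseteq> Y" "card X1 = k" "card Y2 = k"
    and "E \<subseteq> X1 \<times> Y2 \<union> (X - X1) \<times> Y"
proof -
  let ?\<F> = "{F. E \<subseteq> F \<and> F \<subseteq> X \<times> Y \<and> (\<nexists>p. spanning_path (X \<union> Y) F p)}"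
  have "finite ?\<F>"
    by (rule finite_subset[of _ "Pow (X \<times> Y)"]) (use fin in auto)
  then obtain F where F: "F \<in> ?\<F>" and max: "\<And>F'. F' \<in> ?\<F> \<Longrightarrow> F \<subseteq> F' \<Longrightarrow> F = F'"
    using finite_has_maximal2[of ?\<F> E] E none by (auto 4 4)
  have EF: "E \<subseteq> F" and FXY: "F \<subseteq> X \<times> Y" and noF: "\<nexists>p. spanning_path (X \<union> Y) F p"
    using F by auto
  have finF: "finite F" using FXY fin by (auto intro: finite_subset)
  have sat: "card (F `` {x}) + card (F\<inverse> `` {y}) \<le> m" if "x \<in> X" "y \<in> Y" "(x, y) \<notin> F" for x y
  proof -
    have "\<exists>p. spanning_path (X \<union> Y) (insert (x, y) F) p"
      using max[of "insert (x, y) F"] that EF FXY by auto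
    then show ?thesis
      using nonadjacent_degree_sum_le[OF fin(1) disj FXY that _ noF] cX by auto
  qed
  have dX: "k \<le> card (F `` {x})" if "x \<in> X" for x
    using degX[OF that] card_mono[of "F `` {x}" "E `` {x}"] EF finF by fastforce
  have dY: "k \<le> card (F\<inverse> `` {y})" if "y \<in> Y" for y
    using degY[OF that] card_mono[of "F\<inverse> `` {y}" "E\<inverse> `` {y}"] EF finF by fastforce
  have ne: "F \<noteq> X \<times> Y"
    using spanning_path_complete_bipartite[OF fin disj] noF cX cY by auto
  have bigF: "(m + 1) * (m - k) < card F" using big card_mono[OF finF EF] by simp
  obtain X1 Y2 where "X1 \<subseteq> X" "Y2 \<subseteq> Y" "card X1 = k" "card Y2 = k"
    and "F = X1 \<times> Y2 \<union> (X - X1) \<times> Y"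
    by (rule saturated_dense_structure[OF fin FXY cX cY _ _ _ ne bigF mk]) (use sat dX dY in auto)
  then show thesis using that[of X1 Y2] EF by simp
qed

section \<open>The spectral radius and weightings of the first part\<close>

text \<open>
  Some eigenvalue exists over the complex numbers, and it is real because the matrix is Hermitian;
  being a root of the real characteristic polynomial, it is an eigenvalue over the reals.
\<close>

lemma real_symmetric_spectrum_nonempty:
  fixes A :: "real mat"
  assumes A: "A \<in> carrier_mat n n" and n: "n > 0"
    and sym: "\<And>i j. i < n \<Longrightarrow> j < n \<Longrightarrow> A $$ (i, j) = A $$ (j, i)"
  shows "spectrum A \<noteq> {}"
proof -
  define C where "C = map_mat complex_of_real A"
  have C: "C \<in> carrier_mat n n" using A by (simp add: C_def)
  obtain l where l: "eigenvalue C l"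
    using spectrum_non_empty[OF C n] by (auto simp: spectrum_def)
  then obtain v where v: "v \<in> carrier_vec n" "v \<noteq> 0\<^sub>v n" "C *\<^sub>v v = l \<cdot>\<^sub>v v"
    using C unfolding eigenvalue_def eigenvector_def by auto
  have ev: "(\<Sum>j\<in>{0..<n}. of_real (A $$ (i, j)) * v $ j) = l * v $ i" if "i < n" for i
  proof -
    have "(C *\<^sub>v v) $ i = l * v $ i" using v that by simp
    moreover have "(C *\<^sub>v v) $ i = (\<Sum>j\<in>{0..<n}. of_real (A $$ (i, j)) * v $ j)"
      using A C v(1) that by (auto simp: scalar_prod_def C_def intro!: sum.cong)
    ultimately show ?thesis by simp
  qed
  \<comment> \<open>\<open>l s\<close> is the value of the Hermitian form at \<open>v\<close>, hence real.\<close>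
  define s where "s = (\<Sum>i\<in>{0..<n}. cnj (v $ i) * v $ i)"
  have s: "s = of_real (\<Sum>i\<in>{0..<n}. (cmod (v $ i))\<^sup>2)"
    unfolding s_def of_real_sum
    by (intro sum.cong refl) (metis complex_norm_square mult.commute)
  have "s \<noteq> 0"
  proof
    assume "s = 0"
    then have "(\<Sum>i\<in>{0..<n}. (cmod (v $ i))\<^sup>2) = 0" using s by (metis of_real_eq_0_iff)
    then have "\<forall>i\<in>{0..<n}. v $ i = 0" by (simp add: sum_nonneg_eq_0_iff)
    then show False using v(1,2) by auto
  qed
  have ls: "l * s = (\<Sum>i\<in>{0..<n}. \<Sum>j\<in>{0..<n}. of_real (A $$ (i, j)) * (cnj (v $ i) * v $ j))"
    (is "_ = ?q")
  proof -
    have "l * s = (\<Sum>i\<in>{0..<n}. cnj (v $ i) * (l * v $ i))"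
      by (simp add: s_def sum_distrib_left mult_ac)
    also have "\<dots> = (\<Sum>i\<in>{0..<n}. cnj (v $ i) * (\<Sum>j\<in>{0..<n}. of_real (A $$ (i, j)) * v $ j))"
      by (intro sum.cong) (auto simp: ev)
    also have "\<dots> = ?q" by (simp add: sum_distrib_left mult_ac)
    finally show ?thesis .
  qed
  have "cnj ?q = (\<Sum>i\<in>{0..<n}. \<Sum>j\<in>{0..<n}. of_real (A $$ (j, i)) * (cnj (v $ j) * v $ i))"
    by (auto simp: sym mult_ac intro!: sum.cong)
  also have "\<dots> = ?q" by (rule sum.swap)
  finally have "cnj (l * s) = l * s" using ls by simp
  then have "cnj l * s = l * s" using s by simp
  then have "cnj l = l" using \<open>s \<noteq> 0\<close> by simp
  then have lr: "l = of_real (Re l)" by (metis Reals_cnj_iff of_real_Re)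
  have "poly (char_poly C) l = 0" using l eigenvalue_root_char_poly[OF C] by simp
  then have "poly (map_poly complex_of_real (char_poly A)) (of_real (Re l)) = 0"
    using lr unfolding C_def of_real_hom.char_poly_hom[OF A] by simp
  then have "poly (char_poly A) (Re l) = 0" by (simp add: of_real_hom.poly_map_poly)
  then show ?thesis using eigenvalue_root_char_poly[OF A] by (auto simp: spectrum_def)
qed

text \<open>
  An eigenvector, read as a function on the vertices; from here on the numbering of the vertices no
  longer matters.
\<close>

lemma eigenfunction_adjacency_matrix:
  assumes dist: "distinct vs" and ev: "eigenvalue (adjacency_matrix H vs) \<mu>"
  obtains f where "\<exists>u\<in>set vs. f u \<noteq> 0"
    and "\<And>u. u \<in> set vs \<Longrightarrow> \<mu> * f u = (\<Sum>w | w \<in> set vs \<and> (u, w) \<in> parcs H. f w)"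
proof -
  let ?m = "length vs"
  let ?A = "adjacency_matrix H vs"
  obtain v where v: "v \<in> carrier_vec ?m" "v \<noteq> 0\<^sub>v ?m" "?A *\<^sub>v v = \<mu> \<cdot>\<^sub>v v"
    using ev unfolding eigenvalue_def eigenvector_def by (auto simp: adjacency_matrix_def)
  have bij: "bij_betw ((!) vs) {0..<?m} (set vs)"
    using bij_betw_nth[OF dist] by (simp add: atLeast0LessThan)
  define f where "f u = v $ the_inv_into {0..<?m} ((!) vs) u" for u
  have f: "f (vs ! i) = v $ i" if "i < ?m" for i
    unfolding f_def using bij that by (simp add: bij_betw_def the_inv_into_f_f)
  show thesis
  proof
    show "\<exists>u\<in>set vs. f u \<noteq> 0"
    proof (rule ccontr)
      assume "\<not> ?thesis"
      then have "v $ i = 0" if "i < ?m" for i using that f[OF that] nth_mem[OF that] by metis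
      then have "v = 0\<^sub>v ?m" using v(1) by (intro eq_vecI) auto
      then show False using v(2) by simp
    qed
    fix u assume "u \<in> set vs"
    then obtain i where i: "i < ?m" "u = vs ! i" by (metis in_set_conv_nth)
    have "\<mu> * f u = (?A *\<^sub>v v) $ i" using v i f by simp
    also have "\<dots> = (\<Sum>j\<in>{0..<?m}. if (u, vs ! j) \<in> parcs H then f (vs ! j) else 0)"
      using v(1) i f by (auto simp: scalar_prod_def adjacency_matrix_def intro!: sum.cong)
    also have "\<dots> = (\<Sum>w\<in>set vs. if (u, w) \<in> parcs H then f w else 0)"
      by (rule sum.reindex_bij_betw[OF bij])
    also have "\<dots> = (\<Sum>w | w \<in> set vs \<and> (u, w) \<in> parcs H. f w)"
      by (simp add: sum.inter_filter)
    finally show "\<mu> * f u = \<dots>" .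
  qed
qed

lemma eigenfunction_graph_spectral_radius:
  assumes "finite (pverts H)" "pverts H \<noteq> {}"
    and sym: "\<And>u w. (u, w) \<in> parcs H \<longleftrightarrow> (w, u) \<in> parcs H"
  obtains f where "\<exists>u\<in>pverts H. f u \<noteq> 0"
    and "\<And>u. u \<in> pverts H \<Longrightarrow>
      graph_spectral_radius H * f u = (\<Sum>w | w \<in> pverts H \<and> (u, w) \<in> parcs H. f w)"
proof -
  define vs where "vs = (SOME vs. distinct vs \<and> set vs = pverts H)"
  have "\<exists>vs. distinct vs \<and> set vs = pverts H"
    using finite_distinct_list[OF assms(1)] by blast
  then have vs: "distinct vs" "set vs = pverts H"
    unfolding vs_def by (metis (mono_tags, lifting) someI_ex)+
  let ?A = "adjacency_matrix H vs"
  have A: "?A \<in> carrier_mat (length vs) (length vs)" by (simp add: adjacency_matrix_def)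
  have "spectrum ?A \<noteq> {}"
    using vs assms(2) sym
    by (intro real_symmetric_spectrum_nonempty[OF A]) (auto simp: adjacency_matrix_def)
  then have "graph_spectral_radius H \<in> spectrum ?A"
    unfolding graph_spectral_radius_def vs_def[symmetric]
    using card_finite_spectrum(1)[OF A] by (rule Max_in[rotated])
  then have "eigenvalue ?A (graph_spectral_radius H)" by (simp add: spectrum_def)
  from eigenfunction_adjacency_matrix[OF vs(1) this] that show thesis
    unfolding vs(2) by blast
qed

text \<open>
  Let \<open>B\<close> be the biadjacency matrix, with rows indexed by the first part. The restriction \<open>f\<close> of an
  eigenfunction to the first part satisfies \<open>|B\<^sup>T f|\<^sup>2 = \<mu>\<^sup>2 |f|\<^sup>2\<close>, and replacing \<open>f\<close> by its absolute
  value can only increase the left-hand side. Both upper bounds on the spectral radius below are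
  obtained by bounding the right-hand side of the last inequality for nonnegative weights.
\<close>

lemma (in bipartite_graph) spectral_radius_weighting:
  defines "\<mu> \<equiv> graph_spectral_radius (underlying G)"
  assumes ne: "part1 G \<union> part2 G \<noteq> {}" and nz: "\<mu> \<noteq> 0"
  obtains a where "\<And>x. a x \<ge> (0 :: real)" and "\<exists>x\<in>part1 G. a x \<noteq> 0"
    and "\<mu>\<^sup>2 * (\<Sum>x\<in>part1 G. (a x)\<^sup>2) \<le> (\<Sum>y\<in>part2 G. (\<Sum>x\<in>(bedges G)\<inverse> `` {y}. a x)\<^sup>2)"
proof -
  let ?X = "part1 G" and ?Y = "part2 G" and ?E = "bedges G"
  obtain f where f0: "\<exists>u\<in>?X \<union> ?Y. f u \<noteq> 0"
    and f: "\<And>u. u \<in> ?X \<union> ?Y \<Longrightarrow>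
      \<mu> * f u = (\<Sum>w | w \<in> ?X \<union> ?Y \<and> (u, w) \<in> ?E \<union> ?E\<inverse>. f w)"
    using eigenfunction_graph_spectral_radius[of "underlying G"] ne finite_part1 finite_part2
    unfolding \<mu>_def by (auto simp: underlying_def)
  have fX: "\<mu> * f x = (\<Sum>y | y \<in> ?Y \<and> (x, y) \<in> ?E. f y)" if "x \<in> ?X" for x
  proof -
    have "{w. w \<in> ?X \<union> ?Y \<and> (x, w) \<in> ?E \<union> ?E\<inverse>} = {y. y \<in> ?Y \<and> (x, y) \<in> ?E}"
      using that bedges_subset parts_disjoint by auto
    then show ?thesis using f[of x] that by simp
  qed
  have fY: "\<mu> * f y = (\<Sum>x | x \<in> ?X \<and> (x, y) \<in> ?E. f x)" if "y \<in> ?Y" for y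
  proof -
    have "{w. w \<in> ?X \<union> ?Y \<and> (y, w) \<in> ?E \<union> ?E\<inverse>} = {x. x \<in> ?X \<and> (x, y) \<in> ?E}"
      using that bedges_subset parts_disjoint by auto
    then show ?thesis using f[of y] that by simp
  qed
  have nb: "{x. x \<in> ?X \<and> (x, y) \<in> ?E} = ?E\<inverse> `` {y}" for y using bedges_subset by auto
  have "\<mu>\<^sup>2 * (\<Sum>x\<in>?X. (f x)\<^sup>2) = (\<Sum>x\<in>?X. \<mu> * f x * (\<mu> * f x))"
    by (simp add: sum_distrib_left power2_eq_square mult_ac)
  also have "\<dots> = (\<Sum>x\<in>?X. \<Sum>y | y \<in> ?Y \<and> (x, y) \<in> ?E. \<mu> * f x * f y)"
    by (intro sum.cong refl) (metis fX sum_distrib_left)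
  also have "\<dots> = (\<Sum>y\<in>?Y. \<Sum>x | x \<in> ?X \<and> (x, y) \<in> ?E. \<mu> * f x * f y)"
    by (rule sum.swap_restrict[OF finite_part1 finite_part2])
  also have "\<dots> = (\<Sum>y\<in>?Y. (\<Sum>x | x \<in> ?X \<and> (x, y) \<in> ?E. f x) * (\<mu> * f y))"
    by (simp add: sum_distrib_left sum_distrib_right mult_ac)
  also have "\<dots> = (\<Sum>y\<in>?Y. (\<Sum>x\<in>?E\<inverse> `` {y}. f x)\<^sup>2)"
    by (intro sum.cong refl) (simp add: fY power2_eq_square nb)
  finally have eq: "\<mu>\<^sup>2 * (\<Sum>x\<in>?X. (f x)\<^sup>2) = \<dots>" .
  show thesis
  proof
    show "\<bar>f x\<bar> \<ge> 0" for x by simp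
    show "\<exists>x\<in>?X. \<bar>f x\<bar> \<noteq> 0"
    proof (rule ccontr)
      assume "\<not> ?thesis"
      then have z: "\<forall>x\<in>?X. f x = 0" by simp
      have "f y = 0" if "y \<in> ?Y" for y
      proof -
        have "\<mu> * f y = 0" unfolding fY[OF that] using z by (intro sum.neutral) auto
        then show ?thesis using nz by simp
      qed
      then show False using f0 z by auto
    qed
    have "(\<Sum>x\<in>?E\<inverse> `` {y}. f x)\<^sup>2 \<le> (\<Sum>x\<in>?E\<inverse> `` {y}. \<bar>f x\<bar>)\<^sup>2" for y
      by (metis abs_ge_zero power2_abs power_mono sum_abs)
    then show "\<mu>\<^sup>2 * (\<Sum>x\<in>?X. \<bar>f x\<bar>\<^sup>2) \<le> (\<Sum>y\<in>?Y. (\<Sum>x\<in>?E\<inverse> `` {y}. \<bar>f x\<bar>)\<^sup>2)"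
      using eq by (simp add: sum_mono)
  qed
qed

text \<open>
  The operator norm is at most the Frobenius norm; with \<open>spectral_radius_weighting\<close> this is the bound
  \<open>\<mu>\<^sup>2 \<le> |E|\<close> for bipartite graphs.
\<close>

lemma sum_neighbour_weights_le_card:
  assumes fin: "finite X" "finite Y" and E: "E \<subseteq> X \<times> Y"
  shows "(\<Sum>y\<in>Y. (\<Sum>x\<in>E\<inverse> `` {y}. a x)\<^sup>2) \<le> real (card E) * (\<Sum>x\<in>X. (a x :: real)\<^sup>2)"
proof -
  have "(\<Sum>x\<in>E\<inverse> `` {y}. a x)\<^sup>2 \<le> real (card (E\<inverse> `` {y})) * (\<Sum>x\<in>X. (a x)\<^sup>2)" for y
  proof -
    have sub: "E\<inverse> `` {y} \<subseteq> X" using E by auto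
    have "(\<Sum>x\<in>E\<inverse> `` {y}. a x)\<^sup>2 \<le> (\<Sum>x\<in>E\<inverse> `` {y}. (a x)\<^sup>2) * real (card (E\<inverse> `` {y}))"
      by (rule sum_squared_le_sum_of_squares)
    also have "\<dots> \<le> (\<Sum>x\<in>X. (a x)\<^sup>2) * real (card (E\<inverse> `` {y}))"
      by (intro mult_right_mono sum_mono2) (use sub fin in auto)
    finally show ?thesis by (simp add: mult.commute)
  qed
  then have "(\<Sum>y\<in>Y. (\<Sum>x\<in>E\<inverse> `` {y}. a x)\<^sup>2)
      \<le> (\<Sum>y\<in>Y. real (card (E\<inverse> `` {y})) * (\<Sum>x\<in>X. (a x)\<^sup>2))"
    by (rule sum_mono)
  also have "\<dots> = real (card (E\<inverse>)) * (\<Sum>x\<in>X. (a x)\<^sup>2)"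
  proof -
    have "E\<inverse> \<subseteq> Y \<times> X" using E by auto
    from card_eq_sum_degrees[OF fin(2,1) this] show ?thesis by (simp add: sum_distrib_right)
  qed
  finally show ?thesis by simp
qed

section \<open>Proper subgraphs of the extremal graph\<close>

text \<open>
  The left-hand side bounds the squared norm of the neighbour sums in the extremal graph minus one
  edge, where \<open>\<sigma>\<close> is the total weight of the \<open>k\<close> vertices of small degree, \<open>S\<close> the total weight of the
  \<open>N\<close> others and \<open>t\<close> the weight of the end of the missing edge. The bracket on the right is the least
  sum of squares of such weights. For \<open>\<sigma> = 0\<close> and uniform weights the missing edge gains about
  \<open>2 S\<^sup>2 / N\<close>, while the small vertices can win back about \<open>k\<^sup>3 S\<^sup>2 / (n N)\<close>; hence the condition that
  \<open>n\<close> is larger than \<open>k\<^sup>3 / 2\<close>.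
\<close>

lemma extremal_quadratic_form_bound:
  fixes k n N \<sigma> S t :: real
  assumes k: "k \<ge> 1" and n1: "n \<ge> k ^ 3 / 2 + k + 2" and n2: "n \<ge> (k + 1)\<^sup>2"
    and N: "N = n - k - 1"
  shows "k * (\<sigma> + S)\<^sup>2 + (n - k) * S\<^sup>2 + t\<^sup>2 - 2 * t * S
    \<le> n * N * (\<sigma>\<^sup>2 / k + t\<^sup>2 + (S - t)\<^sup>2 / (N - 1))"
proof -
  have kk: "k\<^sup>2 \<ge> k" using k by (simp add: power2_eq_square)
  have NK: "N \<ge> k\<^sup>2 + k" using n2 N by (simp add: power2_eq_square algebra_simps)
  have N2: "N \<ge> 2" and n4: "n \<ge> 4" and nN: "n \<ge> N" using NK kk k N by linarith+
  \<comment> \<open>\<open>d\<close> measures the deviation from the uniform weighting; in the variables \<open>\<sigma>, S, d\<close> the two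
    cross terms are \<open>\<sigma> S\<close> and \<open>d S\<close>, and completing the squares costs \<open>k\<^sup>2 / q\<close> and at most
    \<open>1 / (n N)\<close> times \<open>S\<^sup>2\<close>.\<close>
  define d where "d = t - S / N"
  define q where "q = n * N / k - k"
  have q: "k * q \<ge> N * (n - 1)"
    using NK k unfolding q_def by (simp add: field_simps power2_eq_square)
  have qpos: "q > 0"
  proof -
    have "N * (n - 1) > 0" using N2 n4 by simp
    then show ?thesis using q k by (smt (verit) mult_nonneg_nonpos)
  qed
  \<comment> \<open>The cost is covered by what the missing edge gains; the cubic lower bound on \<open>n\<close> enters here
    only, as \<open>k ^ 3 \<le> 2 (n - 1) - 2 k - 2\<close>.\<close>
  have c1: "k\<^sup>2 / q + 1 / (n * N) \<le> 2 / N - 1 / N\<^sup>2"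
  proof -
    have "k\<^sup>2 / q = k ^ 3 / (k * q)" using k by (simp add: power2_eq_square power3_eq_cube)
    also have "\<dots> \<le> k ^ 3 / (N * (n - 1))"
      using q k N2 n4 qpos by (intro divide_left_mono mult_pos_pos) auto
    also have "\<dots> \<le> (2 * (n - 1) - 2 * k - 2) / (N * (n - 1))"
      using n1 N2 n4 by (intro divide_right_mono) auto
    also have "\<dots> \<le> (2 * (n - 1) - 4) / (N * (n - 1))"
      using k N2 n4 by (intro divide_right_mono) auto
    also have "\<dots> = 2 / N - 1 / (N * (n - 1)) - 3 / (N * (n - 1))"
      using N2 n4 by (simp add: divide_simps)
    finally have a: "k\<^sup>2 / q \<le> 2 / N - 1 / (N * (n - 1)) - 3 / (N * (n - 1))" .
    have b: "1 / (n * N) \<le> 1 / (N * (n - 1))"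
      using N2 n4 by (intro divide_left_mono) (auto simp: algebra_simps)
    have "n - 1 \<le> 3 * N" using NK kk k N by linarith
    then have "3 / (N * (n - 1)) \<ge> 1 / N\<^sup>2"
      using N2 n4 by (simp add: divide_simps power2_eq_square)
    then show ?thesis using a b by linarith
  qed
  have N1: "N - 1 > 0" "N > 0" using N2 by auto
  have e1: "t\<^sup>2 + (S - t)\<^sup>2 / (N - 1) = S\<^sup>2 / N + N / (N - 1) * d\<^sup>2"
    using N1 unfolding d_def
    by (simp add: divide_simps) (simp add: power2_eq_square algebra_simps)
  have "N / (N - 1) \<ge> 1 + 1 / N" using N1 by (simp add: field_simps power2_eq_square)
  then have "N / (N - 1) * d\<^sup>2 \<ge> (1 + 1 / N) * d\<^sup>2" by (rule mult_right_mono) simp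
  then have "n * N * (N / (N - 1) * d\<^sup>2) \<ge> n * N * ((1 + 1 / N) * d\<^sup>2)"
    using n4 N1 by (intro mult_left_mono) auto
  also have "n * N * ((1 + 1 / N) * d\<^sup>2) = n * N * d\<^sup>2 + n * d\<^sup>2"
    using N1 by (simp add: field_simps)
  finally have e2: "n * N * (t\<^sup>2 + (S - t)\<^sup>2 / (N - 1)) \<ge> n * S\<^sup>2 + n * N * d\<^sup>2 + n * d\<^sup>2"
    unfolding e1 using N1 by (simp add: distrib_left)
  have e3: "n * N * (\<sigma>\<^sup>2 / k) = q * \<sigma>\<^sup>2 + k * \<sigma>\<^sup>2"
    unfolding q_def using k by (simp add: field_simps)
  have e4: "2 * t * S - t\<^sup>2 = 2 / N * S\<^sup>2 - 1 / N\<^sup>2 * S\<^sup>2 + 2 * (1 - 1 / N) * (d * S) - d\<^sup>2"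
  proof -
    have t: "t = S / N + d" by (simp add: d_def)
    show ?thesis unfolding t using N1 by (simp add: field_simps power2_eq_square)
  qed
  have s1: "q * \<sigma>\<^sup>2 - 2 * k * \<sigma> * S \<ge> - (k\<^sup>2 / q) * S\<^sup>2"
  proof -
    have "q * \<sigma>\<^sup>2 - 2 * k * \<sigma> * S + (k\<^sup>2 / q) * S\<^sup>2 = (q * \<sigma> - k * S)\<^sup>2 / q"
      using qpos by (simp add: field_simps power2_eq_square)
    also have "\<dots> \<ge> 0" using qpos by simp
    finally show ?thesis by simp
  qed
  have s2: "n * N * d\<^sup>2 + 2 * (1 - 1 / N) * (d * S) \<ge> - (1 / (n * N)) * S\<^sup>2"
  proof -
    define r where "r = 1 - 1 / N"
    define M where "M = n * N"
    have r: "0 \<le> r" "r \<le> 1" using N2 by (auto simp: r_def)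
    have M: "M > 0" using n4 N1 by (simp add: M_def)
    have "M * d\<^sup>2 + 2 * r * (d * S) + r\<^sup>2 / M * S\<^sup>2 = (M * d + r * S)\<^sup>2 / M"
      using M by (simp add: field_simps power2_eq_square)
    also have "\<dots> \<ge> 0" using M by simp
    finally have "M * d\<^sup>2 + 2 * r * (d * S) \<ge> - (r\<^sup>2 / M * S\<^sup>2)" by simp
    moreover have "r\<^sup>2 / M * S\<^sup>2 \<le> 1 / M * S\<^sup>2"
      using r M by (intro mult_right_mono divide_right_mono) (auto simp: power_le_one)
    ultimately show ?thesis unfolding r_def M_def by simp
  qed
  have s3: "n * d\<^sup>2 \<ge> d\<^sup>2" using n4 mult_right_mono[of 1 n "d\<^sup>2"] by simp
  have s4: "(k\<^sup>2 / q) * S\<^sup>2 + 1 / (n * N) * S\<^sup>2 \<le> 2 / N * S\<^sup>2 - 1 / N\<^sup>2 * S\<^sup>2"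
    using mult_right_mono[OF c1, of "S\<^sup>2"] by (simp add: algebra_simps)
  have e5: "k * (\<sigma> + S)\<^sup>2 + (n - k) * S\<^sup>2 = k * \<sigma>\<^sup>2 + 2 * k * \<sigma> * S + n * S\<^sup>2"
    by (simp add: power2_eq_square algebra_simps)
  have e6: "n * N * (\<sigma>\<^sup>2 / k + t\<^sup>2 + (S - t)\<^sup>2 / (N - 1))
      = n * N * (\<sigma>\<^sup>2 / k) + n * N * (t\<^sup>2 + (S - t)\<^sup>2 / (N - 1))"
    by (simp add: distrib_left)
  show ?thesis unfolding e6 using e2 e3 e4 e5 s1 s2 s3 s4 by linarith
qed

text \<open>
  The bound for the sum of squares is weakest when \<open>x0 y0\<close> is the only missing edge and \<open>y0\<close> lies
  outside \<open>Y2\<close>. By the Cauchy-Schwarz inequality it is enough to treat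
  weights that are constant on \<open>X1\<close> and on the rest of \<open>X\<close> apart from \<open>x0\<close>, which is the quadratic form
  of \<open>extremal_quadratic_form_bound\<close>.
\<close>

lemma proper_subgraph_weight_bound:
  fixes k n :: nat and a :: "'a \<Rightarrow> real"
  assumes fin: "finite X" "finite Y" and cX: "card X + 1 = n" and cY: "card Y = n"
    and sub: "X1 \<subseteq> X" "Y2 \<subseteq> Y" and c: "card X1 = k" "card Y2 = k"
    and E: "E \<subseteq> X1 \<times> Y2 \<union> (X - X1) \<times> Y"
    and missing: "x0 \<in> X - X1" "y0 \<in> Y" "(x0, y0) \<notin> E"
    and a: "\<And>x. a x \<ge> 0"
    and k: "k \<ge> 1" and n1: "real n \<ge> real k ^ 3 / 2 + real k + 2" and n2: "real n \<ge> (real k + 1)\<^sup>2"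
  shows "(\<Sum>y\<in>Y. (\<Sum>x\<in>E\<inverse> `` {y}. a x)\<^sup>2) \<le> real n * (real n - real k - 1) * (\<Sum>x\<in>X. (a x)\<^sup>2)"
proof -
  define X2 where "X2 = X - X1"
  define \<sigma> where "\<sigma> = (\<Sum>x\<in>X1. a x)"
  define S where "S = (\<Sum>x\<in>X2. a x)"
  define t where "t = a x0"
  have fin': "finite X1" "finite X2" "finite Y2"
    using fin sub by (auto simp: X2_def intro: finite_subset)
  have nonneg: "\<sigma> \<ge> 0" "S \<ge> 0" "t \<ge> 0" using a by (auto simp: \<sigma>_def S_def t_def sum_nonneg)
  have x0: "x0 \<in> X2" using missing by (simp add: X2_def)
  have tS: "(\<Sum>x\<in>X2 - {x0}. a x) = S - t"
    using sum.remove[OF fin'(2) x0, of a] by (simp add: S_def t_def)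
  have "t \<le> S" using tS sum_nonneg[of "X2 - {x0}" a] a by simp
  let ?w = "\<lambda>y. (\<Sum>x\<in>E\<inverse> `` {y}. a x)\<^sup>2"
  let ?h = "\<lambda>y. if y \<in> Y2 then (\<sigma> + S)\<^sup>2 else S\<^sup>2"
  have w_le: "?w y \<le> u\<^sup>2" if "finite A" "E\<inverse> `` {y} \<subseteq> A" "sum a A \<le> u" for y A u
  proof (rule power_mono)
    show "(\<Sum>x\<in>E\<inverse> `` {y}. a x) \<le> u"
      using sum_mono2[OF that(1,2), of a] a that(3) by simp
    show "0 \<le> (\<Sum>x\<in>E\<inverse> `` {y}. a x)" using a by (simp add: sum_nonneg)
  qed
  have X1X2: "X1 \<inter> X2 = {}" by (auto simp: X2_def)
  have gen: "?w y \<le> ?h y" if "y \<in> Y" for y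
  proof (cases "y \<in> Y2")
    case True
    have "?w y \<le> (\<sigma> + S)\<^sup>2"
    proof (rule w_le)
      show "finite (X1 \<union> X2)" "E\<inverse> `` {y} \<subseteq> X1 \<union> X2" using fin' E by (auto simp: X2_def)
      show "sum a (X1 \<union> X2) \<le> \<sigma> + S"
        using sum.union_disjoint[OF fin'(1,2) X1X2, of a] by (simp add: \<sigma>_def S_def)
    qed
    then show ?thesis using True by simp
  next
    case False
    have "?w y \<le> S\<^sup>2"
      by (rule w_le[of X2]) (use fin' E False in \<open>auto simp: X2_def S_def\<close>)
    then show ?thesis using False by simp
  qed
  \<comment> \<open>At \<open>y0\<close> the bound \<open>\<sigma> + S\<close> or \<open>S\<close> on the neighbour sum drops by \<open>t\<close>. Its square drops by
    \<open>2 t S - t\<^sup>2\<close>, and by another \<open>2 t \<sigma>\<close> if \<open>y0\<close> lies in \<open>Y2\<close>.\<close>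
  have spec: "?w y0 \<le> ?h y0 + (t\<^sup>2 - 2 * t * S)"
  proof (cases "y0 \<in> Y2")
    case True
    have "?w y0 \<le> (\<sigma> + (S - t))\<^sup>2"
    proof (rule w_le)
      show "finite (X1 \<union> (X2 - {x0}))" "E\<inverse> `` {y0} \<subseteq> X1 \<union> (X2 - {x0})"
        using fin' E missing by (auto simp: X2_def)
      show "sum a (X1 \<union> (X2 - {x0})) \<le> \<sigma> + (S - t)"
      proof -
        have "X1 \<inter> (X2 - {x0}) = {}" using X1X2 by blast
        then show ?thesis using sum.union_disjoint[of X1 "X2 - {x0}" a] fin' tS by (simp add: \<sigma>_def)
      qed
    qed
    also have "\<dots> = (\<sigma> + S)\<^sup>2 + (t\<^sup>2 - 2 * t * S) - 2 * (t * \<sigma>)"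
      by (simp add: power2_eq_square algebra_simps)
    also have "\<dots> \<le> (\<sigma> + S)\<^sup>2 + (t\<^sup>2 - 2 * t * S)" using nonneg by simp
    finally show ?thesis using True by simp
  next
    case False
    have "?w y0 \<le> (S - t)\<^sup>2"
      by (rule w_le[of "X2 - {x0}"]) (use fin' E False missing tS in \<open>auto simp: X2_def\<close>)
    then show ?thesis using False by (simp add: power2_eq_square algebra_simps)
  qed
  have "(\<Sum>y\<in>Y. ?w y) = ?w y0 + (\<Sum>y\<in>Y - {y0}. ?w y)"
    using sum.remove[OF fin(2) missing(2)] .
  also have "\<dots> \<le> (?h y0 + (t\<^sup>2 - 2 * t * S)) + (\<Sum>y\<in>Y - {y0}. ?h y)"
    using spec gen by (intro add_mono sum_mono) auto
  also have "\<dots> = (\<Sum>y\<in>Y. ?h y) + (t\<^sup>2 - 2 * t * S)"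
    using sum.remove[OF fin(2) missing(2), of ?h] by linarith
  also have "(\<Sum>y\<in>Y. ?h y) = real k * (\<sigma> + S)\<^sup>2 + (real n - real k) * S\<^sup>2"
  proof -
    have "Y \<inter> {y. y \<in> Y2} = Y2" "Y \<inter> - {y. y \<in> Y2} = Y - Y2" using sub by auto
    moreover have "card (Y - Y2) = n - k" "k \<le> n"
      using card_Diff_subset[OF fin'(3) sub(2)] card_mono[OF fin(2) sub(2)] c cY by auto
    ultimately show ?thesis using fin c by (simp add: sum.If_cases of_nat_diff)
  qed
  also have "real k * (\<sigma> + S)\<^sup>2 + (real n - real k) * S\<^sup>2 + (t\<^sup>2 - 2 * t * S)
      \<le> real n * (real n - real k - 1)
        * (\<sigma>\<^sup>2 / real k + t\<^sup>2 + (S - t)\<^sup>2 / (real n - real k - 1 - 1))"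
    using extremal_quadratic_form_bound[of "real k" "real n" "real n - real k - 1" \<sigma> S t] k n1 n2
    by (simp add: algebra_simps)
  also have "\<dots> \<le> real n * (real n - real k - 1) * (\<Sum>x\<in>X. (a x)\<^sup>2)"
  proof (rule mult_left_mono)
    \<comment> \<open>\<open>n - k - 2\<close> is the number of vertices of \<open>X2\<close> other than \<open>x0\<close>.\<close>
    have N: "real n - real k - 1 - 1 > 0"
    proof -
      have "(real k + 1)\<^sup>2 = real k * real k + 2 * real k + 1" "real k * real k \<ge> 1"
        using k mult_mono[of 1 "real k" 1 "real k"] by (auto simp: power2_eq_square algebra_simps)
      then show ?thesis using n2 k by linarith
    qed
    then show "real n * (real n - real k - 1) \<ge> 0" by simp
    have "\<sigma>\<^sup>2 \<le> (\<Sum>x\<in>X1. (a x)\<^sup>2) * real k"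
      unfolding \<sigma>_def using sum_squared_le_sum_of_squares[of a X1] c by simp
    then have 1: "\<sigma>\<^sup>2 / real k \<le> (\<Sum>x\<in>X1. (a x)\<^sup>2)" using k by (simp add: divide_le_eq)
    have cX2: "real (card (X2 - {x0})) = real n - real k - 1 - 1"
    proof -
      have "card X2 = card X - k" "k \<le> card X"
        using card_Diff_subset[OF fin'(1) sub(1)] card_mono[OF fin(1) sub(1)] c by (auto simp: X2_def)
      then show ?thesis using x0 fin' cX N by (simp add: of_nat_diff)
    qed
    have "(S - t)\<^sup>2 \<le> (\<Sum>x\<in>X2 - {x0}. (a x)\<^sup>2) * (real n - real k - 1 - 1)"
      using sum_squared_le_sum_of_squares[of a "X2 - {x0}"] unfolding tS cX2 .
    then have "(S - t)\<^sup>2 / (real n - real k - 1 - 1) \<le> (\<Sum>x\<in>X2 - {x0}. (a x)\<^sup>2)"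
      using N by (simp add: divide_le_eq)
    also have "\<dots> = (\<Sum>x\<in>X2. (a x)\<^sup>2) - t\<^sup>2"
      using sum.remove[OF fin'(2) x0, of "\<lambda>x. (a x)\<^sup>2"] by (simp add: t_def)
    finally have 2: "(S - t)\<^sup>2 / (real n - real k - 1 - 1) \<le> (\<Sum>x\<in>X2. (a x)\<^sup>2) - t\<^sup>2" .
    have "X = X1 \<union> X2" using sub by (auto simp: X2_def)
    then have "(\<Sum>x\<in>X. (a x)\<^sup>2) = (\<Sum>x\<in>X1. (a x)\<^sup>2) + (\<Sum>x\<in>X2. (a x)\<^sup>2)"
      using sum.union_disjoint[OF fin'(1,2) X1X2] by simp
    then show "\<sigma>\<^sup>2 / real k + t\<^sup>2 + (S - t)\<^sup>2 / (real n - real k - 1 - 1) \<le> (\<Sum>x\<in>X. (a x)\<^sup>2)"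
      using 1 2 by linarith
  qed
  finally show ?thesis .
qed

section \<open>The extremal graph up to isomorphism\<close>

lemma digraph_iso_underlyingI:
  assumes "bipartite_graph G"
    and inj: "inj_on \<phi> (part1 G \<union> part2 G)"
    and "\<phi> ` part1 G = part1 H" "\<phi> ` part2 G = part2 H"
    and "map_prod \<phi> \<phi> ` bedges G = bedges H"
  shows "digraph_iso (underlying G) (underlying H)"
proof -
  interpret bipartite_graph G by fact
  interpret pair_graph "underlying G" by (rule pair_graph_underlying)
  define f where "f = \<lparr>iso_verts = \<phi>, iso_arcs = map_prod \<phi> \<phi>, iso_head = snd, iso_tail = fst\<rparr>"
  have arcs: "parcs (underlying G) \<subseteq> (part1 G \<union> part2 G) \<times> (part1 G \<union> part2 G)"
    using bedges_subset by (auto simp: underlying_def)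
  have "inj_on (map_prod \<phi> \<phi>) (parcs (underlying G))"
    using map_prod_inj_on[OF inj inj] arcs by (rule inj_on_subset)
  moreover have "wf_digraph (with_proj (underlying G))" by (rule wf_digraph_axioms)
  ultimately have "pre_digraph.digraph_isomorphism (with_proj (underlying G)) f"
    using inj unfolding pre_digraph.digraph_isomorphism_def f_def
    by (auto simp: underlying_def)
  moreover have "with_proj (underlying H) = app_iso f (with_proj (underlying G))"
  proof -
    have "map_prod \<phi> \<phi> ` (bedges G)\<inverse> = (bedges H)\<inverse>"
      unfolding assms(5)[symmetric] by force
    then show ?thesis
      unfolding app_iso_def f_def with_proj_def underlying_def
      by (simp add: image_Un assms(3-5))
  qed
  ultimately show ?thesis unfolding digraph_iso_def by blast
qed

lemma digraph_iso_C_graph: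
  assumes "bipartite_graph G" and card: "card (part1 G) + 1 = n" "card (part2 G) = n"
    and sub: "X1 \<subseteq> part1 G" "Y2 \<subseteq> part2 G" and k: "card X1 = k" "card Y2 = k"
    and E: "bedges G = X1 \<times> Y2 \<union> (part1 G - X1) \<times> part2 G"
  shows "digraph_iso (underlying G) (underlying (C_graph n k))"
proof -
  interpret bipartite_graph G by fact
  let ?X = "part1 G" and ?Y = "part2 G"
  have bij: "\<exists>g. bij_betw g S {..<m}" if "finite S" "card S = m" for S :: "'a set" and m
    using ex_bij_betw_finite_nat[OF that(1)] that(2) by (simp add: atLeast0LessThan)
  have fin: "finite X1" "finite Y2" using sub finite_part1 finite_part2 by (auto intro: finite_subset)
  have c: "card (?X - X1) = n - k - 1" "card (?Y - Y2) = n - k"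
    using card k sub fin by (auto simp: card_Diff_subset)
  obtain g1 where g1: "bij_betw g1 X1 {..<k}" using bij fin k by blast
  obtain g2 where g2: "bij_betw g2 (?X - X1) {..<n - k - 1}" using bij c finite_part1 by blast
  obtain g3 where g3: "bij_betw g3 (?Y - Y2) {..<n - k}" using bij c finite_part2 by blast
  obtain g4 where g4: "bij_betw g4 Y2 {..<k}" using bij fin k by blast
  define \<phi> where "\<phi> u = (if u \<in> X1 then Inl (Inl (g1 u)) else if u \<in> ?X then Inr (Inl (g2 u))
      else if u \<in> Y2 then Inr (Inr (g4 u)) else Inl (Inr (g3 u)))" for u
  have im1: "\<phi> ` X1 = Inl ` Inl ` {..<k}"
    unfolding bij_betw_imp_surj_on[OF g1, symmetric] image_image
    by (rule image_cong) (auto simp: \<phi>_def)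
  have im2: "\<phi> ` (?X - X1) = Inr ` Inl ` {..<n - k - 1}"
    unfolding bij_betw_imp_surj_on[OF g2, symmetric] image_image
    by (rule image_cong) (auto simp: \<phi>_def)
  have im3: "\<phi> ` (?Y - Y2) = Inl ` Inr ` {..<n - k}"
    unfolding bij_betw_imp_surj_on[OF g3, symmetric] image_image
    by (rule image_cong) (use sub parts_disjoint in \<open>auto simp: \<phi>_def\<close>)
  have im4: "\<phi> ` Y2 = Inr ` Inr ` {..<k}"
    unfolding bij_betw_imp_surj_on[OF g4, symmetric] image_image
    by (rule image_cong) (use sub parts_disjoint in \<open>auto simp: \<phi>_def\<close>)
  have imX: "\<phi> ` ?X = Inl ` Inl ` {..<k} \<union> Inr ` Inl ` {..<n - k - 1}"
    using im1 im2 sub(1) by (metis image_Un Un_Diff_cancel sup.absorb2)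
  have imY: "\<phi> ` ?Y = Inl ` Inr ` {..<n - k} \<union> Inr ` Inr ` {..<k}"
    using im3 im4 sub(2) by (metis image_Un Un_Diff_cancel2 sup.absorb1)
  have "inj_on \<phi> (?X \<union> ?Y)"
  proof (rule inj_onI)
    fix u v assume "u \<in> ?X \<union> ?Y" "v \<in> ?X \<union> ?Y" "\<phi> u = \<phi> v"
    then show "u = v"
      unfolding \<phi>_def
      by (auto split: if_splits
          intro: inj_onD[OF bij_betw_imp_inj_on[OF g1]] inj_onD[OF bij_betw_imp_inj_on[OF g2]]
            inj_onD[OF bij_betw_imp_inj_on[OF g3]] inj_onD[OF bij_betw_imp_inj_on[OF g4]])
  qed
  moreover have "map_prod \<phi> \<phi> ` bedges G = bedges (C_graph n k)"
  proof -
    have prod: "map_prod \<phi> \<phi> ` (A \<times> B) = \<phi> ` A \<times> \<phi> ` B" for A B by force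
    have "map_prod \<phi> \<phi> ` bedges G = \<phi> ` X1 \<times> \<phi> ` Y2 \<union> \<phi> ` (?X - X1) \<times> \<phi> ` ?Y"
      by (simp add: E image_Un prod)
    also have "\<dots> = bedges (C_graph n k)"
      unfolding im1 im2 im4 imY C_graph_def bip_join_def empty_bip_def complete_bip_def by auto
    finally show ?thesis .
  qed
  ultimately show ?thesis
    using imX imY
    by (intro digraph_iso_underlyingI[OF assms(1)])
      (auto simp: C_graph_def bip_join_def empty_bip_def complete_bip_def Plus_def)
qed

section \<open>Spectral condition for traceability\<close>

lemma (in bipartite_graph) out_degree_underlying:
  shows "x \<in> part1 G \<Longrightarrow> out_degree (underlying G) x = card (bedges G `` {x})"
    and "y \<in> part2 G \<Longrightarrow> out_degree (underlying G) y = card ((bedges G)\<inverse> `` {y})"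
proof -
  have *: "out_degree (underlying G) u = card ((bedges G \<union> (bedges G)\<inverse>) `` {u})" for u
  proof -
    have "out_arcs (underlying G) u = Pair u ` ((bedges G \<union> (bedges G)\<inverse>) `` {u})"
      by (auto simp: out_arcs_def underlying_def)
    then show ?thesis by (simp add: out_degree_def card_image inj_on_def)
  qed
  show "out_degree (underlying G) x = card (bedges G `` {x})" if "x \<in> part1 G"
  proof -
    have "(bedges G \<union> (bedges G)\<inverse>) `` {x} = bedges G `` {x}"
      using that bedges_subset parts_disjoint by auto
    then show ?thesis using * by simp
  qed
  show "out_degree (underlying G) y = card ((bedges G)\<inverse> `` {y})" if "y \<in> part2 G"
  proof -
    have "(bedges G \<union> (bedges G)\<inverse>) `` {y} = (bedges G)\<inverse> `` {y}"
      using that bedges_subset parts_disjoint by auto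
    then show ?thesis using * by simp
  qed
qed

theorem theorem3p9:
  fixes G :: "'a bipgraph" and n k :: nat
  assumes "k \<ge> 1"
    and "real n \<ge> max (real k ^ 3 / 2 + real k + 2) ((real k + 1) ^ 2)"
    and "bipartite_graph G"
    and "nearly_balanced G"
    and "graph_order (underlying G) = 2 * n - 1"
    and "min_degree (underlying G) \<ge> k"
    and "graph_spectral_radius (underlying G) > sqrt (real n * (real n - real k - 1))"
  shows "traceable (underlying G) \<or> digraph_iso (underlying G) (underlying (C_graph n k))"
proof (cases "traceable (underlying G)")
  case False
  interpret bipartite_graph G by fact
  let ?X = "part1 G" and ?Y = "part2 G" and ?E = "bedges G"
  let ?\<mu> = "graph_spectral_radius (underlying G)"
  have n1: "real n \<ge> real k ^ 3 / 2 + real k + 2" and n2: "real n \<ge> (real k + 1)\<^sup>2"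
    using assms(2) by auto
  have n2': "(k + 1)\<^sup>2 \<le> n"
    using n2 by (metis of_nat_1 of_nat_add of_nat_le_iff of_nat_power)
  then have kn: "k + 1 \<le> n" using le_trans[of "k + 1" "(k + 1)\<^sup>2" n] by (simp add: power2_eq_square)
  have "card (?X \<union> ?Y) = card ?X + card ?Y"
    by (rule card_Un_disjoint[OF finite_part1 finite_part2 parts_disjoint])
  then have cX: "card ?X + 1 = n" and cY: "card ?Y = n"
    using assms(4,5) by (auto simp: nearly_balanced_def graph_order_def underlying_def)
  have ne: "?X \<union> ?Y \<noteq> {}" using cY kn by auto
  have deg: "k \<le> out_degree (underlying G) u" if "u \<in> ?X \<union> ?Y" for u
  proof -
    have "min_degree (underlying G) \<le> out_degree (underlying G) u"
      unfolding min_degree_def using finite_part1 finite_part2 that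
      by (intro Min_le) (auto simp: underlying_def)
    then show ?thesis using assms(6) by simp
  qed
  have degX: "k \<le> card (?E `` {x})" if "x \<in> ?X" for x
    using deg out_degree_underlying(1)[OF that] that by (metis UnI1)
  have degY: "k \<le> card (?E\<inverse> `` {y})" if "y \<in> ?Y" for y
    using deg out_degree_underlying(2)[OF that] that by (metis UnI2)

  have pos: "real n * (real n - real k - 1) \<ge> 0" using kn by simp
  then have "?\<mu> > 0" using assms(7) by (meson le_less_trans real_sqrt_ge_zero)
  have mu: "?\<mu>\<^sup>2 > real n * (real n - real k - 1)"
    using power_strict_mono[OF assms(7), of 2] pos by simp
  obtain a where a: "\<And>x. a x \<ge> (0 :: real)" "\<exists>x\<in>?X. a x \<noteq> 0"
    and ray: "?\<mu>\<^sup>2 * (\<Sum>x\<in>?X. (a x)\<^sup>2) \<le> (\<Sum>y\<in>?Y. (\<Sum>x\<in>?E\<inverse> `` {y}. a x)\<^sup>2)"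
    using spectral_radius_weighting ne \<open>?\<mu> > 0\<close> by (metis less_irrefl)
  have apos: "(\<Sum>x\<in>?X. (a x)\<^sup>2) > 0"
    using a(2) finite_part1 by (auto intro: sum_pos2)

  have "?\<mu>\<^sup>2 * (\<Sum>x\<in>?X. (a x)\<^sup>2) \<le> real (card ?E) * (\<Sum>x\<in>?X. (a x)\<^sup>2)"
    using ray sum_neighbour_weights_le_card[OF finite_part1 finite_part2 bedges_subset, of a] by linarith
  then have "?\<mu>\<^sup>2 \<le> real (card ?E)" using apos by simp
  then have "real n * (real n - real k - 1) < real (card ?E)" using mu by linarith
  then have "real ((card ?X + 1) * (card ?X - k)) < real (card ?E)"
    using cX kn by (auto simp: of_nat_diff algebra_simps)
  then have big: "(card ?X + 1) * (card ?X - k) < card ?E" by (rule of_nat_less_imp_less)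

  have none: "\<nexists>p. spanning_path (?X \<union> ?Y) ?E p" using False traceable_underlying_iff[OF ne] by simp
  obtain X1 Y2 where sub: "X1 \<subseteq> ?X" "Y2 \<subseteq> ?Y" and c: "card X1 = k" "card Y2 = k"
    and E: "?E \<subseteq> X1 \<times> Y2 \<union> (?X - X1) \<times> ?Y"
    by (rule dense_nontraceable_structure[OF finite_part1 finite_part2 parts_disjoint bedges_subset
          refl _ none _ _ big]) (use cX cY n2' degX degY in auto)
  \<comment> \<open>The vertices of \<open>X1\<close> have at least \<open>k\<close> neighbours, all of them in \<open>Y2\<close>.\<close>
  have X1Y2: "X1 \<times> Y2 \<subseteq> ?E"
  proof -
    have "?E `` {x} = Y2" if "x \<in> X1" for x
    proof (rule card_seteq)
      show "finite Y2" using sub finite_part2 by (auto intro: finite_subset)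
      show "?E `` {x} \<subseteq> Y2" using E that by auto
      show "card Y2 \<le> card (?E `` {x})" using c degX that sub by auto
    qed
    then show ?thesis by auto
  qed
  have "(?X - X1) \<times> ?Y \<subseteq> ?E"
  proof (rule ccontr)
    assume "\<not> ?thesis"
    then obtain x0 y0 where "x0 \<in> ?X - X1" "y0 \<in> ?Y" "(x0, y0) \<notin> ?E" by auto
    from proper_subgraph_weight_bound[where a = a, OF finite_part1 finite_part2 cX cY sub c E this a(1)
        assms(1) n1 n2]
    have "?\<mu>\<^sup>2 * (\<Sum>x\<in>?X. (a x)\<^sup>2) \<le> real n * (real n - real k - 1) * (\<Sum>x\<in>?X. (a x)\<^sup>2)"
      using ray by linarith
    then show False using apos mu by (simp add: mult_le_cancel_right)
  qed
  then have "?E = X1 \<times> Y2 \<union> (?X - X1) \<times> ?Y" using E X1Y2 by auto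
  then show ?thesis using digraph_iso_C_graph[OF assms(3) cX cY sub c] by simp
qed simp

end
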